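(* Let $I_S\subset\mathbb{C}[a,b]$ be the Sibirsky ideal, and let $I_{\mathsf{L}}\subset\mathbb{C}[a,b]$ be the lattice ideal of the lattice $\mathsf{L}=\{\nu-\hat\nu:\nu\in\mathcal{M}\}\subset\mathbb{Z}^{2\ell}$. Then $I_S=I_{\mathsf{L}}$.
   Context: Let $\mathbb{N}_0=\{0,1,2,\dots\}$ and let $S=\{(p_1,q_1),\dots,(p_\ell,q_\ell)\}\subset(\mathbb{N}_0\cup\{-1\})\times\mathbb{N}_0$ be a set of $\ell$ distinct pairs with $p_j+q_j\ge1$ for all $j$. $\mathbb{C}[a,b]$ is the polynomial ring in the $2\ell$ independent variables $a_{p_1q_1},\dots,a_{p_\ell q_\ell},b_{q_\ell p_\ell},\dots,b_{q_1p_1}$ (in this order). For $\nu\in\mathbb{N}_0^{2\ell}$: $[\nu]=a_{p_1q_1}^{\nu_1}\cdots a_{p_\ell q_\ell}^{\nu_\ell}b_{q_\ell p_\ell}^{\nu_{\ell+1}}\cdots b_{q_1p_1}^{\nu_{2\ell}}$, $\hat\nu=(\nu_{2\ell},\nu_{2\ell-1},\dots,\nu_1)$, and $L(\nu)=\sum_{j=1}^\ell\big[\binom{p_j}{q_j}\nu_j+\binom{q_j}{p_j}\nu_{2\ell-j+1}\big]$. $\mathcal{M}=\{\nu\in\mathbb{N}_0^{2\ell}:L(\nu)=\binom KK\text{ for some }K\in\mathbb{N}_0\}$. The Sibirsky ideal is $I_S=\langle[\nu]-[\hat\nu]:\nu\in\mathcal{M}\rangle$. The set $\mathsf{L}$ is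 a subgroup of $\mathbb{Z}^{2\ell}$. For $m\in\mathbb{Z}^{2\ell}$ write $m=m^+-m^-$ with $m^\pm\in\mathbb{N}_0^{2\ell}$ of disjoint supports ($m^+_i=\max(m_i,0)$, $m^-_i=\max(-m_i,0)$). The lattice ideal of $\mathsf{L}$ is $I_{\mathsf{L}}=\langle[m^+]-[m^-]:m\in\mathsf{L}\rangle$. *)

theory Defs
  imports Complex_Main "HOL-Library.Poly_Mapping" "HOL-Library.Product_Plus" "HOL-Algebra.Ideal"
begin

text \<open>
  Vectors with entries indexed by \<open>1, \<dots>, n\<close> (\<open>n = 2\<ell>\<close>) are finitely supported functions on
  \<^typ>\<open>nat\<close> that vanish outside \<open>{1..n}\<close>.
\<close>

definition vectors :: "nat \<Rightarrow> (nat \<Rightarrow>\<^sub>0 'a::zero) set" where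
  "vectors n = {v. Poly_Mapping.keys v \<subseteq> {1..n}}"

definition hat :: "nat \<Rightarrow> (nat \<Rightarrow>\<^sub>0 nat) \<Rightarrow> (nat \<Rightarrow>\<^sub>0 nat)" where
  "hat l \<nu> = (\<Sum>i=1..2*l. Poly_Mapping.single i (Poly_Mapping.lookup \<nu> (2*l + 1 - i)))"

text \<open>
  A polynomial maps exponent vectors to coefficients. The type below has infinitely many variables;
  the ring \<open>\<complex>[a,b]\<close> consists of the polynomials in the first \<open>2\<ell>\<close> of them. They are numbered in
  the order \<open>a_{p\<^sub>1q\<^sub>1}, \<dots>, a_{p\<^sub>\<ell>q\<^sub>\<ell>}, b_{q\<^sub>\<ell>p\<^sub>\<ell>}, \<dots>, b_{q\<^sub>1p\<^sub>1}\<close>, so variable \<open>j\<close> is \<open>a_{p\<^sub>jq\<^sub>j}\<close> and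
  variable \<open>2\<ell> - j + 1\<close> is \<open>b_{q\<^sub>jp\<^sub>j}\<close> for \<open>1 \<le> j \<le> \<ell>\<close>.
\<close>

type_synonym cpoly = "(nat \<Rightarrow>\<^sub>0 nat) \<Rightarrow>\<^sub>0 complex"

definition C_ab :: "nat \<Rightarrow> cpoly ring" where
  "C_ab l = \<lparr>carrier = {f. Poly_Mapping.keys f \<subseteq> vectors (2*l)},
     mult = (*), one = 1, zero = 0, add = (+)\<rparr>"

definition var :: "nat \<Rightarrow> cpoly" where
  "var i = Poly_Mapping.single (Poly_Mapping.single i 1) 1"

definition monomial :: "nat \<Rightarrow> (nat \<Rightarrow>\<^sub>0 nat) \<Rightarrow> cpoly" where
  "monomial l \<nu> = (\<Prod>i=1..2*l. var i ^ Poly_Mapping.lookup \<nu> i)"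

text \<open>The pairs of \<open>S\<close> are \<open>(p j, q j)\<close> for \<open>1 \<le> j \<le> \<ell>\<close>.\<close>

definition L_map :: "nat \<Rightarrow> (nat \<Rightarrow> int) \<Rightarrow> (nat \<Rightarrow> nat) \<Rightarrow> (nat \<Rightarrow>\<^sub>0 nat) \<Rightarrow> int \<times> int" where
  "L_map l p q \<nu> = (\<Sum>j=1..l.
     (p j * int (Poly_Mapping.lookup \<nu> j), int (q j) * int (Poly_Mapping.lookup \<nu> j)) +
     (int (q j) * int (Poly_Mapping.lookup \<nu> (2*l - j + 1)),
      p j * int (Poly_Mapping.lookup \<nu> (2*l - j + 1))))"

definition sib_monoid :: "nat \<Rightarrow> (nat \<Rightarrow> int) \<Rightarrow> (nat \<Rightarrow> nat) \<Rightarrow> (nat \<Rightarrow>\<^sub>0 nat) set" where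
  "sib_monoid l p q = {\<nu> \<in> vectors (2*l). \<exists>K::nat. L_map l p q \<nu> = (int K, int K)}"

definition sibirsky_ideal :: "nat \<Rightarrow> (nat \<Rightarrow> int) \<Rightarrow> (nat \<Rightarrow> nat) \<Rightarrow> cpoly set" where
  "sibirsky_ideal l p q =
     Idl\<^bsub>C_ab l\<^esub> {monomial l \<nu> - monomial l (hat l \<nu>) |\<nu>. \<nu> \<in> sib_monoid l p q}"

definition sib_lattice :: "nat \<Rightarrow> (nat \<Rightarrow> int) \<Rightarrow> (nat \<Rightarrow> nat) \<Rightarrow> (nat \<Rightarrow>\<^sub>0 int) set" where
  "sib_lattice l p q =
     {Poly_Mapping.map int \<nu> - Poly_Mapping.map int (hat l \<nu>) |\<nu>. \<nu> \<in> sib_monoid l p q}"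

text \<open>Since \<^const>\<open>nat\<close> truncates negative integers to \<open>0\<close>, these are \<open>max(m\<^sub>i, 0)\<close> and \<open>max(-m\<^sub>i, 0)\<close>.\<close>

definition pos_part :: "(nat \<Rightarrow>\<^sub>0 int) \<Rightarrow> (nat \<Rightarrow>\<^sub>0 nat)" where
  "pos_part m = Poly_Mapping.map nat m"

definition neg_part :: "(nat \<Rightarrow>\<^sub>0 int) \<Rightarrow> (nat \<Rightarrow>\<^sub>0 nat)" where
  "neg_part m = Poly_Mapping.map nat (- m)"

definition lattice_ideal :: "nat \<Rightarrow> (nat \<Rightarrow>\<^sub>0 int) set \<Rightarrow> cpoly set" where
  "lattice_ideal l \<Lambda> =
     Idl\<^bsub>C_ab l\<^esub> {monomial l (pos_part m) - monomial l (neg_part m) |m. m \<in> \<Lambda>}"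

lemma lookup_map0: "f 0 = 0 \<Longrightarrow> Poly_Mapping.lookup (Poly_Mapping.map f v) i = f (Poly_Mapping.lookup v i)"
  by (simp add: Poly_Mapping.map.rep_eq when_def)

lemma lookup_hat:
  "Poly_Mapping.lookup (hat l \<nu>) i =
     (if i \<in> {1..2*l} then Poly_Mapping.lookup \<nu> (2*l + 1 - i) else 0)"
  by (simp add: hat_def Poly_Mapping.lookup_sum lookup_single when_def)

lemma vectors_iff: "v \<in> vectors n \<longleftrightarrow> (\<forall>i. i \<notin> {1..n} \<longrightarrow> Poly_Mapping.lookup v i = 0)"
  by (auto simp: vectors_def in_keys_iff)

lemma hat_vectors: "hat l \<nu> \<in> vectors (2*l)"
  by (auto simp: vectors_iff lookup_hat)

lemma monomial_eq_single:
  assumes "\<nu> \<in> vectors (2*l)"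
  shows "monomial l \<nu> = Poly_Mapping.single \<nu> 1"
proof -
  have pow: "var i ^ k = Poly_Mapping.single (Poly_Mapping.single i k) 1" for i k
    by (induction k) (simp_all add: var_def mult_single flip: single_add)
  have "(\<Prod>i\<in>A. Poly_Mapping.single (Poly_Mapping.single i (Poly_Mapping.lookup \<nu> i)) (1::complex))
      = Poly_Mapping.single (\<Sum>i\<in>A. Poly_Mapping.single i (Poly_Mapping.lookup \<nu> i)) 1"
    if "finite A" for A
    using that by induction (simp_all add: mult_single)
  moreover have "(\<Sum>i=1..2*l. Poly_Mapping.single i (Poly_Mapping.lookup \<nu> i)) = \<nu>"
    using assms by (intro poly_mapping_eqI) (auto simp: vectors_iff Poly_Mapping.lookup_sum lookup_single when_def)
  ultimately show ?thesis by (simp add: monomial_def pow)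
qed

text \<open>
  \<^const>\<open>genideal\<close> is the intersection of all ideals containing the given set, so it has its usual
  meaning because \<open>C_ab l\<close> is a ring and contains the generators.
\<close>

lemma cring_C_ab: "cring (C_ab l)"
proof -
  have sum_closed: "u + v \<in> vectors n" if "u \<in> vectors n" "v \<in> vectors n"
    for u v :: "nat \<Rightarrow>\<^sub>0 nat" and n
    using that by (auto simp: vectors_iff lookup_add)
  have add_closed: "Poly_Mapping.keys (f + g) \<subseteq> V"
    if "Poly_Mapping.keys f \<subseteq> V" "Poly_Mapping.keys g \<subseteq> V" for f g :: cpoly and V
    using that Poly_Mapping.keys_add[of f g] by blast
  have mult_closed: "Poly_Mapping.keys (f * g) \<subseteq> vectors n"
    if "Poly_Mapping.keys f \<subseteq> vectors n" "Poly_Mapping.keys g \<subseteq> vectors n" for f g :: cpoly and n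
    using that keys_mult[of f g] sum_closed by blast
  have one_closed: "Poly_Mapping.keys (1 :: cpoly) \<subseteq> vectors n" for n
    by (simp add: vectors_def)
  show ?thesis
  proof (rule cringI)
    show "abelian_group (C_ab l)"
    proof (rule abelian_groupI)
      fix f assume "f \<in> carrier (C_ab l)"
      then show "\<exists>g\<in>carrier (C_ab l). g \<oplus>\<^bsub>C_ab l\<^esub> f = \<zero>\<^bsub>C_ab l\<^esub>"
        by (intro bexI[of _ "- f"]) (auto simp: C_ab_def)
    qed (use add_closed in \<open>auto simp: C_ab_def add_ac\<close>)
    show "comm_monoid (C_ab l)"
      by (rule comm_monoidI) (use mult_closed one_closed in \<open>auto simp: C_ab_def mult_ac\<close>)
  qed (auto simp: C_ab_def algebra_simps)
qed

lemma monomial_closed: "monomial l \<nu> \<in> carrier (C_ab l)"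
proof -
  interpret cring "C_ab l" by (rule cring_C_ab)
  have eq: "one (C_ab l) = 1" "mult (C_ab l) = (*)" by (simp_all add: C_ab_def)
  have var: "var i \<in> carrier (C_ab l)" if "i \<in> {1..2*l}" for i
    using that by (auto simp: C_ab_def var_def vectors_def)
  have pow: "var i ^ k \<in> carrier (C_ab l)" if "i \<in> {1..2*l}" for i k
    using one_closed m_closed[OF var[OF that]] by (induction k) (simp_all add: eq)
  have "(\<Prod>i\<in>A. var i ^ Poly_Mapping.lookup \<nu> i) \<in> carrier (C_ab l)" if "A \<subseteq> {1..2*l}" for A
    using finite_subset[OF that finite_atLeastAtMost] that one_closed m_closed[OF pow]
    by induction (auto simp: eq)
  then show ?thesis by (simp add: monomial_def)
qed

lemma monomial_diff_closed: "monomial l \<mu> - monomial l \<nu> \<in> carrier (C_ab l)"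
  using monomial_closed[of l \<mu>] monomial_closed[of l \<nu>]
    keys_diff[of "monomial l \<mu>" "monomial l \<nu>"] by (auto simp: C_ab_def)

text \<open>The set \<open>sib_lattice l p q\<close> is a subgroup of \<open>\<int>\<^sup>2\<^sup>\<ell>\<close>.\<close>

lemma L_map_zero: "L_map l p q 0 = 0"
  by (simp add: L_map_def flip: zero_prod_def)

lemma L_map_add: "L_map l p q (\<mu> + \<nu>) = L_map l p q \<mu> + L_map l p q \<nu>"
  by (simp add: L_map_def lookup_add algebra_simps flip: sum.distrib)

lemma L_map_hat: "L_map l p q (hat l \<nu>) = prod.swap (L_map l p q \<nu>)"
proof -
  have swap: "prod.swap (sum f A) = (\<Sum>x\<in>A. prod.swap (f x))" if "finite A"
    for f :: "nat \<Rightarrow> int \<times> int" and A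
    using that by induction (simp_all add: prod_eq_iff)
  show ?thesis unfolding L_map_def swap[OF finite_atLeastAtMost]
    by (intro sum.cong refl) (auto simp: lookup_hat Suc_diff_le)
qed

lemma sib_monoid_hat: "\<nu> \<in> sib_monoid l p q \<Longrightarrow> hat l \<nu> \<in> sib_monoid l p q"
  by (auto simp: sib_monoid_def hat_vectors L_map_hat)

lemma hat_hat: "\<nu> \<in> vectors (2*l) \<Longrightarrow> hat l (hat l \<nu>) = \<nu>"
  by (intro poly_mapping_eqI) (auto simp: lookup_hat vectors_iff)

lemma sib_lattice_subset: "sib_lattice l p q \<subseteq> vectors (2*l)"
  by (auto simp: sib_lattice_def vectors_iff sib_monoid_def lookup_minus lookup_map0 lookup_hat)

lemma sib_lattice_zero: "0 \<in> sib_lattice l p q"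
proof -
  have "(0 :: nat \<Rightarrow>\<^sub>0 nat) \<in> sib_monoid l p q"
    by (auto simp: sib_monoid_def vectors_def L_map_zero zero_prod_def intro!: exI[of _ 0])
  moreover have "hat l 0 = 0" by (simp add: hat_def)
  ultimately show ?thesis by (force simp: sib_lattice_def)
qed

lemma sib_lattice_uminus: "m \<in> sib_lattice l p q \<Longrightarrow> - m \<in> sib_lattice l p q"
  unfolding sib_lattice_def
  by clarify (metis (no_types, lifting) hat_hat mem_Collect_eq minus_diff_eq sib_monoid_def sib_monoid_hat)

lemma sib_lattice_add:
  assumes "m \<in> sib_lattice l p q" "n \<in> sib_lattice l p q"
  shows "m + n \<in> sib_lattice l p q"
proof -
  obtain \<mu> \<nu> where \<mu>: "\<mu> \<in> sib_monoid l p q" "m = Poly_Mapping.map int \<mu> - Poly_Mapping.map int (hat l \<mu>)"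
    and \<nu>: "\<nu> \<in> sib_monoid l p q" "n = Poly_Mapping.map int \<nu> - Poly_Mapping.map int (hat l \<nu>)"
    using assms by (auto simp: sib_lattice_def)
  have "\<mu> + \<nu> \<in> sib_monoid l p q"
    using \<mu>(1) \<nu>(1) by (auto simp: sib_monoid_def vectors_iff lookup_add L_map_add simp flip: of_nat_add)
  moreover have "m + n = Poly_Mapping.map int (\<mu> + \<nu>) - Poly_Mapping.map int (hat l (\<mu> + \<nu>))"
    unfolding \<mu>(2) \<nu>(2)
    by (intro poly_mapping_eqI) (auto simp: lookup_add lookup_minus lookup_map0 lookup_hat)
  ultimately show ?thesis by (auto simp: sib_lattice_def)
qed

end

theory Submission
  imports Defs
begin

text \<open>
  Reduction of a binomial by the common factor of its terms links the two generating sets. Let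
  \<open>\<nu>\<close> be in the monoid and \<open>m = \<nu> - hat \<nu>\<close>. The common factor of \<open>[\<nu>]\<close> and \<open>[hat \<nu>]\<close> has the
  exponent \<open>g = min \<nu> (hat \<nu>)\<close>, so that \<open>\<nu> = g + m\<^sup>+\<close> and \<open>hat \<nu> = g + m\<^sup>-\<close>
  (\<open>hat_common_factor\<close>). Hence \<open>[\<nu>] - [hat \<nu>] = [g] ([m\<^sup>+] - [m\<^sup>-])\<close>, which puts the Sibirsky
  ideal inside the lattice ideal.

  For the other inclusion, \<open>hat m = - m\<close> gives \<open>hat (m\<^sup>+) = m\<^sup>-\<close>, so it is enough that \<open>m\<^sup>+\<close> again lies
  in the monoid (\<open>pos_part_in_sib_monoid\<close>): then \<open>[m\<^sup>+] - [m\<^sup>-]\<close> is itself a generator of the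
  Sibirsky ideal. The exponent \<open>g\<close> is invariant under \<open>hat\<close>, which under \<open>L\<close> becomes the swap of
  coordinates; so \<open>L g\<close> is on the diagonal, and \<open>L m\<^sup>+ = L \<nu> - L g\<close> is there as well. Its
  two equal coordinates are nonnegative because their sum weights the entries of \<open>m\<^sup>+\<close> by the
  numbers \<open>p j + q j\<close>, which are positive.
\<close>

text \<open>
  Only the sum of the coordinates has a sign, since \<open>p j\<close> may be \<open>-1\<close>. On the diagonal this
  is enough.
\<close>

lemma L_map_coordinate_sum_nonneg:
  assumes "\<forall>j\<in>{1..l}. p j + int (q j) \<ge> 0"
  shows "fst (L_map l p q \<nu>) + snd (L_map l p q \<nu>) \<ge> 0"
proof -
  have "fst (L_map l p q \<nu>) + snd (L_map l p q \<nu>) =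
    (\<Sum>j=1..l. (p j + int (q j)) *
       (int (Poly_Mapping.lookup \<nu> j) + int (Poly_Mapping.lookup \<nu> (2*l - j + 1))))"
    by (simp add: L_map_def fst_sum snd_sum algebra_simps flip: sum.distrib)
  also have "\<dots> \<ge> 0"
    using assms by (intro sum_nonneg mult_nonneg_nonneg) auto
  finally show ?thesis .
qed

lemma L_map_hat_invariant:
  assumes "hat l g = g"
  shows "fst (L_map l p q g) = snd (L_map l p q g)"
  using L_map_hat[of l p q g] assms by (metis fst_swap)

lemma hat_common_factor:
  assumes "\<nu> \<in> vectors (2*l)"
    and m: "m = Poly_Mapping.map int \<nu> - Poly_Mapping.map int (hat l \<nu>)"
  obtains g where "g \<in> vectors (2*l)" "hat l g = g"
    "\<nu> = g + pos_part m" "hat l \<nu> = g + neg_part m"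
proof
  \<comment> \<open>Truncated subtraction makes this the pointwise minimum of \<open>\<nu>\<close> and \<open>hat l \<nu>\<close>.\<close>
  let ?g = "\<nu> - pos_part m"
  note [simp] = pos_part_def neg_part_def lookup_map0 lookup_minus lookup_add lookup_hat m
  have supp: "Poly_Mapping.lookup \<nu> i = 0" if "i \<notin> {1..2*l}" for i
    using assms(1) that by (simp add: vectors_iff)
  show "?g \<in> vectors (2*l)"
    using supp by (auto simp: vectors_iff)
  show "hat l ?g = ?g"
    using supp by (intro poly_mapping_eqI) auto
  show "\<nu> = ?g + pos_part m" "hat l \<nu> = ?g + neg_part m"
    using supp by (auto intro!: poly_mapping_eqI)
qed

lemma pos_part_vectors: "m \<in> vectors n \<Longrightarrow> pos_part m \<in> vectors n"
  by (simp add: vectors_iff pos_part_def lookup_map0)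

lemma neg_part_vectors: "m \<in> vectors n \<Longrightarrow> neg_part m \<in> vectors n"
  by (simp add: vectors_iff neg_part_def lookup_map0)

lemma hat_add: "hat l (\<mu> + \<nu>) = hat l \<mu> + hat l \<nu>"
  by (intro poly_mapping_eqI) (simp add: lookup_hat lookup_add)

lemma hat_pos_part:
  assumes "m \<in> sib_lattice l p q"
  shows "hat l (pos_part m) = neg_part m"
proof -
  obtain \<nu> where \<nu>: "\<nu> \<in> vectors (2*l)"
    and m: "m = Poly_Mapping.map int \<nu> - Poly_Mapping.map int (hat l \<nu>)"
    using assms by (auto simp: sib_lattice_def sib_monoid_def)
  obtain g where "hat l g = g" "\<nu> = g + pos_part m" "hat l \<nu> = g + neg_part m"
    using hat_common_factor[OF \<nu> m] by metis
  then show ?thesis by (metis hat_add add_left_cancel)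
qed

lemma pos_part_in_sib_monoid:
  assumes nonneg: "\<forall>j\<in>{1..l}. p j + int (q j) \<ge> 0"
    and "m \<in> sib_lattice l p q"
  shows "pos_part m \<in> sib_monoid l p q"
proof -
  obtain \<nu> K where \<nu>: "\<nu> \<in> vectors (2*l)" and K: "L_map l p q \<nu> = (int K, int K)"
    and m: "m = Poly_Mapping.map int \<nu> - Poly_Mapping.map int (hat l \<nu>)"
    using assms(2) by (auto simp: sib_lattice_def sib_monoid_def)
  obtain g where g: "hat l g = g" "\<nu> = g + pos_part m"
    using hat_common_factor[OF \<nu> m] by metis
  let ?L = "L_map l p q (pos_part m)"
  have "L_map l p q g + ?L = (int K, int K)"
    using K g(2) by (metis L_map_add)
  then have diag: "fst ?L = snd ?L"
    using L_map_hat_invariant[OF g(1), of p q] by (auto simp: prod_eq_iff)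
  then have "fst ?L \<ge> 0"
    using L_map_coordinate_sum_nonneg[OF nonneg, of "pos_part m"] by simp
  then have "?L = (int (nat (fst ?L)), int (nat (fst ?L)))"
    using diag by (simp add: prod_eq_iff)
  moreover have "pos_part m \<in> vectors (2*l)"
    using assms(2) sib_lattice_subset pos_part_vectors by blast
  ultimately show ?thesis
    unfolding sib_monoid_def by blast
qed

lemma monomial_add:
  assumes "\<mu> \<in> vectors (2*l)" "\<nu> \<in> vectors (2*l)"
  shows "monomial l (\<mu> + \<nu>) = monomial l \<mu> * monomial l \<nu>"
  using assms by (subst (1 2 3) monomial_eq_single) (auto simp: mult_single vectors_iff lookup_add)

theorem proposition3p5:
  fixes l :: nat and p :: "nat \<Rightarrow> int" and q :: "nat \<Rightarrow> nat"
  assumes "\<forall>j\<in>{1..l}. p j \<ge> -1"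
    and "inj_on (\<lambda>j. (p j, q j)) {1..l}"
    and "\<forall>j\<in>{1..l}. p j + int (q j) \<ge> 1"
  shows "sibirsky_ideal l p q = lattice_ideal l (sib_lattice l p q)"
proof -
  interpret R: cring "C_ab l" by (rule cring_C_ab)
  let ?S = "{monomial l \<nu> - monomial l (hat l \<nu>) |\<nu>. \<nu> \<in> sib_monoid l p q}"
  let ?T = "{monomial l (pos_part m) - monomial l (neg_part m) |m. m \<in> sib_lattice l p q}"
  have S: "?S \<subseteq> carrier (C_ab l)" and T: "?T \<subseteq> carrier (C_ab l)"
    using monomial_diff_closed by auto
  have nonneg: "\<forall>j\<in>{1..l}. p j + int (q j) \<ge> 0"
    using assms(3) by force
  have "?T \<subseteq> ?S"
  proof clarify
    fix m assume m: "m \<in> sib_lattice l p q"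
    then show "\<exists>\<nu>. monomial l (pos_part m) - monomial l (neg_part m) =
        monomial l \<nu> - monomial l (hat l \<nu>) \<and> \<nu> \<in> sib_monoid l p q"
      using pos_part_in_sib_monoid[OF nonneg m] hat_pos_part[OF m] by metis
  qed
  then have "?T \<subseteq> Idl\<^bsub>C_ab l\<^esub> ?S"
    using R.genideal_self[OF S] by (rule subset_trans)
  then have TS: "Idl\<^bsub>C_ab l\<^esub> ?T \<subseteq> Idl\<^bsub>C_ab l\<^esub> ?S"
    by (rule R.genideal_minimal[OF R.genideal_ideal[OF S]])
  interpret T: ideal "Idl\<^bsub>C_ab l\<^esub> ?T" "C_ab l"
    by (rule R.genideal_ideal[OF T])
  have "?S \<subseteq> Idl\<^bsub>C_ab l\<^esub> ?T"
  proof clarify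
    fix \<nu> assume \<nu>: "\<nu> \<in> sib_monoid l p q"
    then have v: "\<nu> \<in> vectors (2*l)" by (simp add: sib_monoid_def)
    define m where "m = Poly_Mapping.map int \<nu> - Poly_Mapping.map int (hat l \<nu>)"
    have m: "m \<in> sib_lattice l p q"
      using \<nu> by (auto simp: m_def sib_lattice_def)
    then have mv: "m \<in> vectors (2*l)"
      using sib_lattice_subset by blast
    obtain g where g: "g \<in> vectors (2*l)" "\<nu> = g + pos_part m" "hat l \<nu> = g + neg_part m"
      using hat_common_factor[OF v m_def] by metis
    have "monomial l \<nu> = monomial l g * monomial l (pos_part m)"
      using monomial_add[OF g(1) pos_part_vectors[OF mv]] g(2) by simp
    moreover have "monomial l (hat l \<nu>) = monomial l g * monomial l (neg_part m)"
      using monomial_add[OF g(1) neg_part_vectors[OF mv]] g(3) by simp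
    ultimately have eq: "monomial l \<nu> - monomial l (hat l \<nu>) =
        monomial l g \<otimes>\<^bsub>C_ab l\<^esub> (monomial l (pos_part m) - monomial l (neg_part m))"
      by (simp add: C_ab_def right_diff_distrib)
    have "monomial l (pos_part m) - monomial l (neg_part m) \<in> Idl\<^bsub>C_ab l\<^esub> ?T"
      using R.genideal_self[OF T] m by blast
    then show "monomial l \<nu> - monomial l (hat l \<nu>) \<in> Idl\<^bsub>C_ab l\<^esub> ?T"
      unfolding eq by (rule T.I_l_closed) (rule monomial_closed)
  qed
  then have "Idl\<^bsub>C_ab l\<^esub> ?S \<subseteq> Idl\<^bsub>C_ab l\<^esub> ?T"
    by (rule R.genideal_minimal[OF T.is_ideal])
  with TS show ?thesis
    by (simp add: sibirsky_ideal_def lattice_ideal_def)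
qed

end
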